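(* Let $M$ and $N$ be infinite metric spaces and let $X$ be an infinite Tychonoff space. Let $\tau$ be any topology on $\mathrm{Lip}_0(N)$ containing the weak topology of the Banach space $\mathrm{Lip}_0(N)$, and let $\tau'$ be any topology on $C(X)$ containing the pointwise topology. Then there is no continuous (linear or not) surjection $T\colon\mathrm{Lip}_0(M)_p\to Y$ for either of the following spaces $Y$: (1) $Y=(\mathrm{Lip}_0(N),\tau)$, (2) $Y=(C(X),\tau')$.
   Context: For a metric space $(M,\rho)$ with a distinguished base point $e$, $\mathrm{Lip}_0(M)$ is the real Banach space of all Lipschitz functions $f\colon M\to\mathbb{R}$ with $f(e)=0$, with norm $\|f\|=\mathrm{Lip}(f)=\sup_{x\neq y}|f(x)-f(y)|/\rho(x,y)$. $\mathrm{Lip}_0(M)_p$ denotes $\mathrm{Lip}_0(M)$ endowed with the topology of pointwise convergence (inherited from $\mathbb{R}^M$). $C(X)$ is the set of all continuous real-valued functions on $X$; its pointwise topology is the one inherited from $\mathbb{R}^X$. *)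

theory Defs
  imports "HOL-Analysis.Analysis"
begin

text \<open>
  A metric space is a value of type \<^typ>\<open>'a metric\<close>, and a real-valued function on a carrier \<open>S\<close> is
  represented by the unique extensional function that agrees with it on \<open>S\<close>. This is also
  the convention for the points of \<^const>\<open>product_topology\<close>.
\<close>

definition Lip0 :: "'a metric \<Rightarrow> 'a \<Rightarrow> ('a \<Rightarrow> real) set" where
  "Lip0 M e = {f \<in> extensional (mspace M).
     Lipschitz_continuous_map M euclidean_metric f \<and> f e = 0}"

definition Lip0_pointwise :: "'a metric \<Rightarrow> 'a \<Rightarrow> ('a \<Rightarrow> real) topology" where
  "Lip0_pointwise M e = subtopology (powertop_real (mspace M)) (Lip0 M e)"

text \<open>
  Inserting 0 changes nothing when \<open>M\<close> has two distinct points; it only makes the supremum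
  meaningful on a one-point space.
\<close>

definition Lip0_norm :: "'a metric \<Rightarrow> ('a \<Rightarrow> real) \<Rightarrow> real" where
  "Lip0_norm M f = Sup (insert 0
     {\<bar>f x - f y\<bar> / mdist M x y | x y. x \<in> mspace M \<and> y \<in> mspace M \<and> x \<noteq> y})"

text \<open>
  The vector space operations of \<^const>\<open>Lip0\<close> are pointwise; the restriction keeps the results
  extensional.
\<close>

definition Lip0_dual :: "'a metric \<Rightarrow> 'a \<Rightarrow> (('a \<Rightarrow> real) \<Rightarrow> real) set" where
  "Lip0_dual M e = {\<phi>.
     (\<forall>f \<in> Lip0 M e. \<forall>g \<in> Lip0 M e. \<phi> (\<lambda>x\<in>mspace M. f x + g x) = \<phi> f + \<phi> g) \<and>
     (\<forall>c. \<forall>f \<in> Lip0 M e. \<phi> (\<lambda>x\<in>mspace M. c * f x) = c * \<phi> f) \<and>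
     (\<exists>C. \<forall>f \<in> Lip0 M e. \<bar>\<phi> f\<bar> \<le> C * Lip0_norm M f)}"

definition Lip0_weak :: "'a metric \<Rightarrow> 'a \<Rightarrow> ('a \<Rightarrow> real) topology" where
  "Lip0_weak M e = topology_generated_by
     {{f \<in> Lip0 M e. \<phi> f \<in> U} | \<phi> U. \<phi> \<in> Lip0_dual M e \<and> open U}"

definition Cfun :: "'a topology \<Rightarrow> ('a \<Rightarrow> real) set" where
  "Cfun X = {f \<in> extensional (topspace X). continuous_map X euclideanreal f}"

definition Cfun_pointwise :: "'a topology \<Rightarrow> ('a \<Rightarrow> real) topology" where
  "Cfun_pointwise X = subtopology (powertop_real (topspace X)) (Cfun X)"

definition tychonoff_space :: "'a topology \<Rightarrow> bool" where
  "tychonoff_space X \<longleftrightarrow> completely_regular_space X \<and> Hausdorff_space X"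

definition topology_contains :: "'a topology \<Rightarrow> 'a topology \<Rightarrow> bool" where
  "topology_contains S T \<longleftrightarrow> topspace S = topspace T \<and> (\<forall>U. openin T U \<longrightarrow> openin S U)"

lemma topspace_Lip0_pointwise [simp]: "topspace (Lip0_pointwise M e) = Lip0 M e"
  by (auto simp: Lip0_pointwise_def Lip0_def PiE_def)

lemma topspace_Cfun_pointwise [simp]: "topspace (Cfun_pointwise X) = Cfun X"
  by (auto simp: Cfun_pointwise_def Cfun_def PiE_def)

lemma topspace_Lip0_weak [simp]: "topspace (Lip0_weak M e) = Lip0 M e"
proof -
  have "(\<lambda>_. 0) \<in> Lip0_dual M e"
    by (auto simp: Lip0_dual_def intro: exI[of _ 0])
  then have "Lip0 M e \<in> {{f \<in> Lip0 M e. \<phi> f \<in> U} | \<phi> U. \<phi> \<in> Lip0_dual M e \<and> open U}"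
    by (auto intro!: exI[of _ "\<lambda>_. 0"] exI[of _ UNIV])
  then show ?thesis
    unfolding Lip0_weak_def topology_generated_by_topspace by blast
qed

end

theory Submission
  imports Defs
begin

text \<open>
  The functions in \<open>Lip0 M e\<close> with Lipschitz constant at most \<open>n\<close> form a pointwise closed
  subset of a product of compact intervals, so \<open>Lip0 M e\<close> with the pointwise topology is
  \<open>\<sigma>\<close>-compact, and so is each of its continuous images
  (\<open>Lip0_pointwise_image_sigma_compact\<close>). Compact sets stay compact in a coarser topology. What
  has to be shown is therefore that neither the weak topology of \<open>Lip0 N e'\<close> nor the pointwise
  topology of \<open>Cfun X\<close> is \<open>\<sigma>\<close>-compact.

  In both spaces compact sets are pointwise compact, hence closed for any complete norm that
  dominates the evaluations. By Baire's theorem (\<open>Baire_pointwise_compact\<close>), if countably many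
  compact sets cover such a normed space, one of them contains a ball, say with centre \<open>f\<close> and
  radius \<open>r\<close>. Every family in that ball then has a cluster point
  (\<open>compactin_filter_cluster\<close>), and a suitable family makes this impossible.

  For \<open>Lip0 N e'\<close>, this amounts to the ball not being weakly compact, that is, to the space not
  being reflexive. Every infinite metric space carries 1-Lipschitz functions \<open>g n\<close> that tend to
  0 pointwise, and pairs of points \<open>x k\<close>, \<open>y k\<close> along which the slope of each late \<open>g n\<close> is
  eventually at least some \<open>c > 0\<close> (\<open>infinite_persistent_slopes\<close>). Subtracting constants makes
  the \<open>g n\<close> vanish at \<open>e'\<close> and changes neither property. A cluster point \<open>\<phi>\<close> of the
  difference quotients at these pairs is a bounded functional
  (\<open>difference_quotient_functional\<close>) with \<open>\<phi> (g n) \<ge> c\<close> for late \<open>n\<close>. The functions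
  \<open>f + (r/2) g n\<close> converge pointwise to \<open>f\<close>, so \<open>f\<close> is their only possible weak cluster point,
  yet \<open>\<phi>\<close> exceeds \<open>\<phi> f\<close> by \<open>r c / 2\<close> along them.

  For \<open>Cfun X\<close>, the norm is the supremum norm on the bounded continuous functions. By complete
  regularity any \<open>h\<close> with values in \<open>[0, 1]\<close> is interpolated on finite sets by continuous
  functions, so \<open>f + (r/2) h\<close> is a cluster point of elements of the ball and hence continuous.
  Thus every \<open>h\<close> is continuous, \<open>X\<close> is discrete, and \<open>Cfun X\<close> contains all functions on an
  infinite set. A diagonal argument shows that these are not covered by countably many compact
  sets (\<open>Cfun_pointwise_not_sigma_compact\<close>).
\<close>

section \<open>Cluster points in compact sets and a Baire argument\<close>

text \<open>
  If every point of \<open>K\<close> violated the claim for some \<open>h\<close> and \<open>C\<close>, the open sets on which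
  \<open>h\<close> avoids \<open>C\<close> would cover \<open>K\<close>, and by a finite subcover \<open>s\<close> would eventually leave \<open>K\<close>.
  Stating clustering through closed conditions on continuous functions lets limits of values,
  identities such as linearity, and inequalities all pass to the cluster point; the filter is
  general because both sequences and nets over finite sets occur.
\<close>

lemma compactin_filter_cluster:
  fixes s :: "'i \<Rightarrow> 'a"
  assumes K: "compactin Z K" and F: "F \<noteq> bot" and s: "\<And>i. s i \<in> K"
  obtains u where "u \<in> K"
    "\<And>h C. \<lbrakk>continuous_map Z euclideanreal h; closed C; \<forall>\<^sub>F i in F. h (s i) \<in> C\<rbrakk> \<Longrightarrow> h u \<in> C"
proof -
  have "\<exists>u\<in>K. \<forall>h C. continuous_map Z euclideanreal h \<and> closed C \<and> (\<forall>\<^sub>F i in F. h (s i) \<in> C)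
    \<longrightarrow> h u \<in> C"
  proof (rule ccontr)
    assume "\<not> ?thesis"
    then have "\<forall>u\<in>K. \<exists>h C. continuous_map Z euclideanreal h \<and> closed C \<and>
        (\<forall>\<^sub>F i in F. h (s i) \<in> C) \<and> h u \<notin> C"
      by blast
    then obtain h C where hC: "\<And>u. u \<in> K \<Longrightarrow> continuous_map Z euclideanreal (h u) \<and> closed (C u) \<and>
        (\<forall>\<^sub>F i in F. h u (s i) \<in> C u) \<and> h u u \<notin> C u"
      by metis
    define V where "V u = {z \<in> topspace Z. h u z \<in> - C u}" for u
    have "openin Z (V u)" if "u \<in> K" for u
      unfolding V_def using hC[OF that]
      by (intro openin_continuous_map_preimage[where Y = euclideanreal]) auto
    then have "\<forall>U\<in>V ` K. openin Z U"
      by blast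
    moreover have "K \<subseteq> \<Union>(V ` K)"
      using hC compactin_subset_topspace[OF K] by (auto simp: V_def)
    ultimately have "\<exists>\<F>. finite \<F> \<and> \<F> \<subseteq> V ` K \<and> K \<subseteq> \<Union>\<F>"
      using K unfolding compactin_def by (elim conjE allE[of _ "V ` K"]) simp
    then obtain \<F> where "finite \<F>" "\<F> \<subseteq> V ` K" and sub: "K \<subseteq> \<Union>\<F>"
      by blast
    then obtain J where J: "finite J" "J \<subseteq> K" "\<F> = V ` J"
      by (meson finite_subset_image)
    have "\<forall>\<^sub>F i in F. \<forall>u\<in>J. h u (s i) \<in> C u"
      using J hC by (intro eventually_ball_finite) auto
    then obtain i where "\<forall>u\<in>J. h u (s i) \<in> C u"
      using F eventually_happens' by blast
    moreover have "s i \<in> \<Union>(V ` J)"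
      using sub s J by blast
    ultimately show False
      by (auto simp: V_def)
  qed
  then show thesis
    using that by blast
qed

text \<open>
  Domination of the evaluations makes the metric topology finer than the pointwise one, so
  pointwise compact sets are closed for the metric and one of them has interior points in \<open>S\<close>.
\<close>

lemma Baire_pointwise_compact:
  fixes S :: "('i \<Rightarrow> real) set"
  assumes S: "Metric_space S d" and compl: "Metric_space.mcomplete S d"
    and ne: "S \<noteq> {}" and ext: "S \<subseteq> extensional I"
    and ev: "\<And>x. x \<in> I \<Longrightarrow> \<exists>B. \<forall>f\<in>S. \<forall>g\<in>S. \<bar>f x - g x\<bar> \<le> B * d f g"
    and K: "\<And>n. compactin (powertop_real I) (K n)" and cover: "S \<subseteq> (\<Union>n::nat. K n)"
  obtains n f r where "f \<in> S" "r > 0" "\<And>g. \<lbrakk>g \<in> S; d f g < r\<rbrakk> \<Longrightarrow> g \<in> K n"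
proof -
  interpret Metric_space S d by fact
  have "continuous_map mtopology euclideanreal (\<lambda>f. f x)" if x: "x \<in> I" for x
  proof -
    have "Lipschitz_continuous_map (metric (S, d)) euclidean_metric (\<lambda>f. f x)"
      using ev[OF x] by (auto simp: Lipschitz_continuous_map_def dist_real_def)
    from Lipschitz_continuous_imp_continuous_map[OF this] show ?thesis
      by simp
  qed
  then have "continuous_map mtopology (powertop_real I) id"
    using ext by (auto simp: continuous_map_componentwise)
  moreover have "closedin (powertop_real I) (K n)" for n
    using K by (intro compactin_imp_closedin) (auto simp: Hausdorff_space_product_topology)
  ultimately have cl: "closedin mtopology (S \<inter> K n)" for n
    using closedin_continuous_map_preimage[of mtopology "powertop_real I" id "K n"]
    by (simp add: Int_def)
  have "mtopology interior_of \<Union>(range (\<lambda>n. S \<inter> K n)) \<noteq> {}"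
  proof -
    have "\<Union>(range (\<lambda>n. S \<inter> K n)) = S"
      using cover by auto
    then show ?thesis
      using ne interior_of_topspace[of mtopology] by simp
  qed
  then obtain n where "mtopology interior_of (S \<inter> K n) \<noteq> {}"
    using metric_Baire_category_alt[OF compl, of "range (\<lambda>n. S \<inter> K n)"] cl by auto
  then obtain U f where U: "openin mtopology U" "f \<in> U" "U \<subseteq> S \<inter> K n"
    by (metis all_not_in_conv interior_of_subset openin_interior_of)
  then obtain r where "r > 0" "mball f r \<subseteq> U"
    by (auto simp: openin_mtopology)
  moreover have "f \<in> S"
    using U by blast
  ultimately have "g \<in> K n" if "g \<in> S" "d f g < r" for g
    using U that in_mball[of g f r] by blast
  then show thesis
    using \<open>f \<in> S\<close> \<open>r > 0\<close> by (intro that)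
qed

section \<open>The Banach space of Lipschitz functions\<close>

lemma Lip0_iff:
  "f \<in> Lip0 M e \<longleftrightarrow> f \<in> extensional (mspace M) \<and> f e = 0 \<and>
    (\<exists>B\<ge>0. \<forall>x\<in>mspace M. \<forall>y\<in>mspace M. \<bar>f x - f y\<bar> \<le> B * mdist M x y)"
proof -
  have "Lipschitz_continuous_map M euclidean_metric f \<longleftrightarrow>
    (\<exists>B\<ge>0. \<forall>x\<in>mspace M. \<forall>y\<in>mspace M. \<bar>f x - f y\<bar> \<le> B * mdist M x y)" (is "?l \<longleftrightarrow> ?r")
  proof
    show "?l \<Longrightarrow> ?r"
      unfolding Lipschitz_continuous_map_pos dist_real_def mdist_euclidean_metric
      using less_imp_le by blast
    show "?r \<Longrightarrow> ?l"
      unfolding Lipschitz_continuous_map_def by (auto simp: dist_real_def)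
  qed
  then show ?thesis
    by (auto simp: Lip0_def)
qed

lemma Lip0I:
  assumes "f \<in> extensional (mspace M)" "f e = 0" "B \<ge> 0"
    "\<And>x y. \<lbrakk>x \<in> mspace M; y \<in> mspace M\<rbrakk> \<Longrightarrow> \<bar>f x - f y\<bar> \<le> B * mdist M x y"
  shows "f \<in> Lip0 M e"
  using assms by (auto simp: Lip0_iff)

lemma Lip0_lincomb:
  assumes "f \<in> Lip0 M e" "g \<in> Lip0 M e" "e \<in> mspace M"
  shows "(\<lambda>x\<in>mspace M. a * f x + b * g x) \<in> Lip0 M e"
proof -
  obtain B C where BC: "B \<ge> 0" "C \<ge> 0"
    "\<And>x y. \<lbrakk>x \<in> mspace M; y \<in> mspace M\<rbrakk> \<Longrightarrow> \<bar>f x - f y\<bar> \<le> B * mdist M x y"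
    "\<And>x y. \<lbrakk>x \<in> mspace M; y \<in> mspace M\<rbrakk> \<Longrightarrow> \<bar>g x - g y\<bar> \<le> C * mdist M x y"
    using assms by (auto simp: Lip0_iff)
  show ?thesis
  proof (rule Lip0I)
    fix x y assume xy: "x \<in> mspace M" "y \<in> mspace M"
    have "\<bar>(a * f x + b * g x) - (a * f y + b * g y)\<bar> \<le> \<bar>a * (f x - f y)\<bar> + \<bar>b * (g x - g y)\<bar>"
      by (simp add: algebra_simps)
    also have "\<dots> \<le> \<bar>a\<bar> * (B * mdist M x y) + \<bar>b\<bar> * (C * mdist M x y)"
      unfolding abs_mult using BC xy by (intro add_mono mult_left_mono) auto
    finally show "\<bar>(\<lambda>x\<in>mspace M. a * f x + b * g x) x - (\<lambda>x\<in>mspace M. a * f x + b * g x) y\<bar>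
      \<le> (\<bar>a\<bar> * B + \<bar>b\<bar> * C) * mdist M x y"
      using xy by (simp add: algebra_simps)
  qed (use assms BC in \<open>auto simp: Lip0_iff\<close>)
qed

lemma Lip0_norm_le:
  assumes "B \<ge> 0"
    "\<And>x y. \<lbrakk>x \<in> mspace M; y \<in> mspace M\<rbrakk> \<Longrightarrow> \<bar>f x - f y\<bar> \<le> B * mdist M x y"
  shows "Lip0_norm M f \<le> B"
  unfolding Lip0_norm_def
proof (rule cSup_least)
  fix t assume "t \<in> insert 0 {\<bar>f x - f y\<bar> / mdist M x y | x y.
    x \<in> mspace M \<and> y \<in> mspace M \<and> x \<noteq> y}"
  then show "t \<le> B"
    using assms by (auto simp: divide_le_eq) (metis mdist_nonneg not_le)+
qed auto

lemma Lip0_norm_bounds: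
  assumes "f \<in> Lip0 M e"
  shows Lip0_norm_nonneg: "0 \<le> Lip0_norm M f"
    and Lip0_norm_bound: "\<lbrakk>x \<in> mspace M; y \<in> mspace M\<rbrakk> \<Longrightarrow> \<bar>f x - f y\<bar> \<le> Lip0_norm M f * mdist M x y"
proof -
  let ?Q = "insert 0 {\<bar>f x - f y\<bar> / mdist M x y | x y. x \<in> mspace M \<and> y \<in> mspace M \<and> x \<noteq> y}"
  obtain B where B: "B \<ge> 0"
    "\<And>x y. \<lbrakk>x \<in> mspace M; y \<in> mspace M\<rbrakk> \<Longrightarrow> \<bar>f x - f y\<bar> \<le> B * mdist M x y"
    using assms by (auto simp: Lip0_iff)
  have pos: "mdist M x y > 0" if "x \<in> mspace M" "y \<in> mspace M" "x \<noteq> y" for x y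
    using that by (metis mdist_nonneg mdist_zero order_le_less)
  have bdd: "bdd_above ?Q"
    using B pos by (intro bdd_aboveI[of _ B]) (auto simp: divide_le_eq)
  show "0 \<le> Lip0_norm M f"
    unfolding Lip0_norm_def by (rule cSup_upper[OF _ bdd]) auto
  show "\<bar>f x - f y\<bar> \<le> Lip0_norm M f * mdist M x y" if xy: "x \<in> mspace M" "y \<in> mspace M"
  proof (cases "x = y")
    case False
    have "\<bar>f x - f y\<bar> / mdist M x y \<le> Lip0_norm M f"
      unfolding Lip0_norm_def using xy False by (intro cSup_upper[OF _ bdd]) auto
    then show ?thesis
      using pos[OF xy False] by (simp add: divide_le_eq)
  qed (simp add: \<open>0 \<le> Lip0_norm M f\<close>)
qed

text \<open>
  On \<open>Lip0 M e\<close> the norm is nonnegative and the absolute value changes nothing. Off it, the norm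
  may be the supremum of an unbounded set, while a metric has to be nonnegative on the whole type.
\<close>

definition Lip0_dist :: "'a metric \<Rightarrow> ('a \<Rightarrow> real) \<Rightarrow> ('a \<Rightarrow> real) \<Rightarrow> real" where
  "Lip0_dist M f g = \<bar>Lip0_norm M (\<lambda>x\<in>mspace M. f x - g x)\<bar>"

lemma Lip0_diff:
  assumes "f \<in> Lip0 M e" "g \<in> Lip0 M e" "e \<in> mspace M"
  shows "(\<lambda>x\<in>mspace M. f x - g x) \<in> Lip0 M e"
  using Lip0_lincomb[OF assms, of 1 "-1"] by simp

context
  fixes M :: "'a metric" and e :: 'a
  assumes e: "e \<in> mspace M"
begin

lemma Lip0_dist_bound:
  assumes "f \<in> Lip0 M e" "g \<in> Lip0 M e" "x \<in> mspace M" "y \<in> mspace M"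
  shows "\<bar>(f x - g x) - (f y - g y)\<bar> \<le> Lip0_dist M f g * mdist M x y"
  using Lip0_norm_bound[OF Lip0_diff[OF assms(1,2) e] assms(3,4)] assms(3,4)
    Lip0_norm_nonneg[OF Lip0_diff[OF assms(1,2) e]]
  by (simp add: Lip0_dist_def)

lemma Lip0_dist_le:
  assumes "f \<in> Lip0 M e" "g \<in> Lip0 M e" "B \<ge> 0"
    "\<And>x y. \<lbrakk>x \<in> mspace M; y \<in> mspace M\<rbrakk> \<Longrightarrow> \<bar>(f x - g x) - (f y - g y)\<bar> \<le> B * mdist M x y"
  shows "Lip0_dist M f g \<le> B"
  unfolding Lip0_dist_def
  using Lip0_norm_nonneg[OF Lip0_diff[OF assms(1,2) e]]
    Lip0_norm_le[of B M "\<lambda>x\<in>mspace M. f x - g x"] assms(3,4) by simp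

lemma Lip0_dist_eval:
  assumes "f \<in> Lip0 M e" "g \<in> Lip0 M e" "x \<in> mspace M"
  shows "\<bar>f x - g x\<bar> \<le> mdist M x e * Lip0_dist M f g"
  using Lip0_dist_bound[OF assms e] assms by (simp add: Lip0_iff mult.commute)

lemma Metric_space_Lip0: "Metric_space (Lip0 M e) (Lip0_dist M)"
proof
  show "Lip0_dist M f g = Lip0_dist M g f" for f g
  proof -
    have "\<bar>(f x - g x) - (f y - g y)\<bar> = \<bar>(g x - f x) - (g y - f y)\<bar>" for x y
      by linarith
    then show ?thesis
      unfolding Lip0_dist_def Lip0_norm_def
      by (intro arg_cong[where f = "\<lambda>A. \<bar>Sup (insert 0 A)\<bar>"] Collect_cong ex_cong1) auto
  qed
  show "(Lip0_dist M f g = 0) = (f = g)" if fg: "f \<in> Lip0 M e" "g \<in> Lip0 M e" for f g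
  proof
    assume "Lip0_dist M f g = 0"
    then have "f x = g x" if "x \<in> mspace M" for x
      using Lip0_dist_eval[OF fg that] by simp
    then show "f = g"
      using fg by (intro extensionalityI[of _ "mspace M"]) (auto simp: Lip0_iff)
  next
    assume "f = g"
    then have "Lip0_dist M f g \<le> 0"
      using fg by (intro Lip0_dist_le) auto
    then show "Lip0_dist M f g = 0"
      by (simp add: Lip0_dist_def)
  qed
  show "Lip0_dist M f h \<le> Lip0_dist M f g + Lip0_dist M g h"
    if "f \<in> Lip0 M e" "g \<in> Lip0 M e" "h \<in> Lip0 M e" for f g h
  proof (rule Lip0_dist_le)
    fix x y assume "x \<in> mspace M" "y \<in> mspace M"
    then show "\<bar>f x - h x - (f y - h y)\<bar> \<le> (Lip0_dist M f g + Lip0_dist M g h) * mdist M x y"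
      using Lip0_dist_bound[of f g x y] Lip0_dist_bound[of g h x y] that
      by (simp add: distrib_right)
  qed (use that in \<open>auto simp: Lip0_dist_def\<close>)
qed (simp add: Lip0_dist_def)

text \<open>
  A Cauchy sequence converges pointwise because evaluations are dominated by the metric. The
  Cauchy estimates for the increments \<open>(\<sigma> n x - \<sigma> m x) - (\<sigma> n y - \<sigma> m y)\<close> survive the limit
  in \<open>m\<close>; this gives both a Lipschitz constant for the limit and convergence in norm.
\<close>

lemma mcomplete_Lip0: "Metric_space.mcomplete (Lip0 M e) (Lip0_dist M)"
proof -
  interpret L: Metric_space "Lip0 M e" "Lip0_dist M"
    by (rule Metric_space_Lip0)
  show ?thesis
    unfolding L.mcomplete_def
  proof (intro allI impI)
    fix \<sigma> assume \<sigma>: "L.MCauchy \<sigma>"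
    then have in_L: "\<sigma> n \<in> Lip0 M e" for n
      by (auto simp: L.MCauchy_def)
    have tail: "\<exists>K. \<forall>n\<ge>K. \<forall>m\<ge>K. Lip0_dist M (\<sigma> n) (\<sigma> m) < \<epsilon>" if "\<epsilon> > 0" for \<epsilon>
      using \<sigma> that by (auto simp: L.MCauchy_def)
    have "convergent (\<lambda>n. \<sigma> n x)" if x: "x \<in> mspace M" for x
      unfolding Cauchy_convergent_iff[symmetric]
    proof (rule metric_CauchyI)
      fix \<epsilon> :: real assume "\<epsilon> > 0"
      define \<delta> where "\<delta> = \<epsilon> / (mdist M x e + 1)"
      have pos: "mdist M x e + 1 > 0"
        using mdist_nonneg[of M x e] by linarith
      obtain K where K: "\<And>n m. \<lbrakk>n \<ge> K; m \<ge> K\<rbrakk> \<Longrightarrow> Lip0_dist M (\<sigma> n) (\<sigma> m) < \<delta>"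
        using tail[of \<delta>] \<open>\<epsilon> > 0\<close> pos by (auto simp: \<delta>_def)
      have "dist (\<sigma> n x) (\<sigma> m x) < \<epsilon>" if "n \<ge> K" "m \<ge> K" for n m
      proof -
        have "\<bar>\<sigma> n x - \<sigma> m x\<bar> \<le> mdist M x e * Lip0_dist M (\<sigma> n) (\<sigma> m)"
          by (rule Lip0_dist_eval[OF in_L in_L x])
        also have "\<dots> \<le> mdist M x e * \<delta>"
          using K[OF that] by (intro mult_left_mono) auto
        also have "\<dots> < \<epsilon>"
          using \<open>\<epsilon> > 0\<close> pos by (simp add: \<delta>_def field_simps)
        finally show ?thesis
          by (simp add: dist_real_def)
      qed
      then show "\<exists>K. \<forall>m\<ge>K. \<forall>n\<ge>K. dist (\<sigma> m x) (\<sigma> n x) < \<epsilon>"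
        by blast
    qed
    then have lim: "(\<lambda>n. \<sigma> n x) \<longlonglongrightarrow> lim (\<lambda>n. \<sigma> n x)" if "x \<in> mspace M" for x
      using that convergent_LIMSEQ_iff by blast
    define f where "f = (\<lambda>x\<in>mspace M. lim (\<lambda>n. \<sigma> n x))"
    have f_lim: "(\<lambda>n. \<sigma> n x) \<longlonglongrightarrow> f x" if "x \<in> mspace M" for x
      using lim[OF that] that by (simp add: f_def)
    have close: "\<bar>(\<sigma> n x - f x) - (\<sigma> n y - f y)\<bar> \<le> \<epsilon> * mdist M x y"
      if "x \<in> mspace M" "y \<in> mspace M" "n \<ge> K"
        and K: "\<forall>n\<ge>K. \<forall>m\<ge>K. Lip0_dist M (\<sigma> n) (\<sigma> m) < \<epsilon>" for n K \<epsilon> x y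
    proof (rule tendsto_upperbound)
      show "(\<lambda>m. \<bar>(\<sigma> n x - \<sigma> m x) - (\<sigma> n y - \<sigma> m y)\<bar>)
          \<longlonglongrightarrow> \<bar>(\<sigma> n x - f x) - (\<sigma> n y - f y)\<bar>"
        using that by (intro tendsto_intros f_lim)
      have "\<bar>(\<sigma> n x - \<sigma> m x) - (\<sigma> n y - \<sigma> m y)\<bar> \<le> \<epsilon> * mdist M x y" if "m \<ge> K" for m
        using Lip0_dist_bound[OF in_L in_L \<open>x \<in> mspace M\<close> \<open>y \<in> mspace M\<close>, of n m] K \<open>n \<ge> K\<close> that
        by (smt (verit, best) mdist_nonneg mult_right_mono)
      then show "\<forall>\<^sub>F m in sequentially. \<bar>(\<sigma> n x - \<sigma> m x) - (\<sigma> n y - \<sigma> m y)\<bar> \<le> \<epsilon> * mdist M x y"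
        by (rule eventually_sequentiallyI)
    qed auto
    have f: "f \<in> Lip0 M e"
    proof -
      obtain K where K: "\<forall>n\<ge>K. \<forall>m\<ge>K. Lip0_dist M (\<sigma> n) (\<sigma> m) < 1"
        using tail[of 1] by auto
      show ?thesis
      proof (rule Lip0I)
        show "f e = 0"
          using f_lim[OF e] in_L by (simp add: Lip0_iff LIMSEQ_const_iff)
        show "\<bar>f x - f y\<bar> \<le> (1 + Lip0_norm M (\<sigma> K)) * mdist M x y"
          if "x \<in> mspace M" "y \<in> mspace M" for x y
          using close[OF that order_refl K] Lip0_norm_bound[OF in_L that, of K]
          by (simp add: distrib_right)
      qed (use Lip0_norm_nonneg[OF in_L, of K] in \<open>auto simp: f_def\<close>)
    qed
    have "limitin L.mtopology \<sigma> f sequentially"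
      unfolding L.limitin_metric
    proof (intro conjI allI impI f)
      fix \<epsilon> :: real assume "\<epsilon> > 0"
      then obtain K where K: "\<forall>n\<ge>K. \<forall>m\<ge>K. Lip0_dist M (\<sigma> n) (\<sigma> m) < \<epsilon> / 2"
        using tail[of "\<epsilon> / 2"] by auto
      have "Lip0_dist M (\<sigma> n) f \<le> \<epsilon> / 2" if "n \<ge> K" for n
        using \<open>\<epsilon> > 0\<close> close[OF _ _ that K] by (intro Lip0_dist_le[OF in_L f]) auto
      then show "\<forall>\<^sub>F n in sequentially. \<sigma> n \<in> Lip0 M e \<and> Lip0_dist M (\<sigma> n) f < \<epsilon>"
        using \<open>\<epsilon> > 0\<close> in_L by (intro eventually_sequentiallyI[of K]) fastforce
    qed
    then show "\<exists>f. limitin L.mtopology \<sigma> f sequentially"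
      by blast
  qed
qed

end

section \<open>Cluster points of difference quotients\<close>

text \<open>
  Each difference quotient is a linear functional of norm at most 1, so the sequence of quotients
  lies in a compact product of intervals. Linearity and the bound are closed conditions, hence
  a cluster point inherits them, as well as each inequality that eventually holds along the
  sequence. It plays the part of a limit along a free ultrafilter.
\<close>

lemma difference_quotient_functional:
  assumes e: "e \<in> mspace M"
    and xy: "\<And>k::nat. x k \<in> mspace M" "\<And>k. y k \<in> mspace M" "\<And>k. x k \<noteq> y k"
  obtains \<phi> where "\<phi> \<in> Lip0_dual M e"
    "\<And>f c. \<lbrakk>f \<in> Lip0 M e; \<forall>\<^sub>F k in sequentially. c * mdist M (x k) (y k) \<le> f (x k) - f (y k)\<rbrakk>
       \<Longrightarrow> c \<le> \<phi> f"
proof -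
  let ?L = "Lip0 M e" and ?D = "\<lambda>k. mdist M (x k) (y k)"
  define q where "q k f = (f (x k) - f (y k)) / ?D k" for k and f :: "'a \<Rightarrow> real"
  have D: "?D k > 0" for k
    using xy by (metis mdist_nonneg mdist_zero order_le_less)
  let ?P = "powertop_real ?L" and ?K = "\<Pi>\<^sub>E f\<in>?L. {- Lip0_norm M f..Lip0_norm M f}"
  have "compactin ?P ?K"
    by (simp add: compactin_PiE)
  moreover have "restrict (q k) ?L \<in> ?K" for k
  proof (rule restrict_PiE_iff[THEN iffD2], rule ballI)
    fix f assume "f \<in> ?L"
    then have "\<bar>q k f\<bar> \<le> Lip0_norm M f"
      using Lip0_norm_bound[of f M e "x k" "y k"] xy D by (simp add: q_def divide_le_eq)
    then show "q k f \<in> {- Lip0_norm M f..Lip0_norm M f}"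
      by auto
  qed
  ultimately obtain \<phi> where \<phi>: "\<phi> \<in> ?K"
    and clus: "\<And>h C. \<lbrakk>continuous_map ?P euclideanreal h; closed C;
      \<forall>\<^sub>F k in sequentially. h (restrict (q k) ?L) \<in> C\<rbrakk> \<Longrightarrow> h \<phi> \<in> C"
    by (rule compactin_filter_cluster[of ?P ?K sequentially "\<lambda>k. restrict (q k) ?L",
        OF _ trivial_limit_sequentially]) blast+
  note proj = continuous_map_product_projection[of _ ?L "\<lambda>_. euclideanreal"]
  show thesis
  proof (rule that[of \<phi>])
    have "\<phi> (\<lambda>x\<in>mspace M. f x + g x) = \<phi> f + \<phi> g" if fg: "f \<in> ?L" "g \<in> ?L" for f g
    proof -
      define s where "s = (\<lambda>x\<in>mspace M. f x + g x)"
      have "s \<in> ?L"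
        using Lip0_lincomb[OF fg e, of 1 1] by (simp add: s_def)
      moreover have "q k s = q k f + q k g" for k
        using xy by (simp add: s_def q_def diff_divide_distrib add_divide_distrib)
      ultimately have "\<phi> s - (\<phi> f + \<phi> g) \<in> {0}"
        using fg by (intro clus continuous_map_diff continuous_map_add proj) auto
      then show ?thesis
        by (simp add: s_def)
    qed
    moreover have "\<phi> (\<lambda>x\<in>mspace M. c * f x) = c * \<phi> f" if f: "f \<in> ?L" for f c
    proof -
      define s where "s = (\<lambda>x\<in>mspace M. c * f x)"
      have "s \<in> ?L"
        using Lip0_lincomb[OF f f e, of c 0] by (simp add: s_def)
      moreover have "q k s = c * q k f" for k
        using xy by (simp add: s_def q_def right_diff_distrib)
      ultimately have "\<phi> s - c * \<phi> f \<in> {0}"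
        using f by (intro clus continuous_map_diff continuous_map_real_mult_left proj) auto
      then show ?thesis
        by (simp add: s_def)
    qed
    moreover have "\<bar>\<phi> f\<bar> \<le> 1 * Lip0_norm M f" if "f \<in> ?L" for f
      using PiE_mem[OF \<phi> that] by auto
    ultimately show "\<phi> \<in> Lip0_dual M e"
      unfolding Lip0_dual_def by blast
    show "c \<le> \<phi> f" if f: "f \<in> ?L" and "\<forall>\<^sub>F k in sequentially. c * ?D k \<le> f (x k) - f (y k)" for f c
    proof -
      have "\<forall>\<^sub>F k in sequentially. restrict (q k) ?L f \<in> {c..}"
        using that(2) by eventually_elim (use D f in \<open>simp add: q_def le_divide_eq\<close>)
      from clus[OF proj[OF f] _ this] show ?thesis
        by simp
    qed
  qed
qed

section \<open>Persistent slopes on infinite metric spaces\<close>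

text \<open>
  Without a finite \<open>\<epsilon>\<close>-net a point at distance at least \<open>\<epsilon>\<close> from any finite set can be
  chosen, and the sequence arises by repeating this choice.
\<close>

lemma (in Metric_space) separated_sequence:
  assumes "\<not> mtotally_bounded M"
  obtains \<epsilon> and z :: "nat \<Rightarrow> 'a" where "\<epsilon> > 0" "\<And>k. z k \<in> M" "\<And>i j. i \<noteq> j \<Longrightarrow> \<epsilon> \<le> d (z i) (z j)"
proof -
  obtain \<epsilon> where \<epsilon>: "\<epsilon> > 0" and no_net: "\<And>K. \<lbrakk>finite K; K \<subseteq> M\<rbrakk> \<Longrightarrow> \<exists>u\<in>M. u \<notin> (\<Union>x\<in>K. mball x \<epsilon>)"
    using assms unfolding mtotally_bounded_def by (meson subsetI)
  obtain p where p: "\<And>K. \<lbrakk>finite K; K \<subseteq> M\<rbrakk> \<Longrightarrow> p K \<in> M \<and> p K \<notin> (\<Union>x\<in>K. mball x \<epsilon>)"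
    using no_net by metis
  define z where "z = wfrec less_than (\<lambda>s n. p (s ` {..<n}))"
  have z_eq: "z n = p (z ` {..<n})" for n
    by (simp add: cut_apply def_wfrec[OF z_def[THEN eq_reflection]])
  have z_M: "z n \<in> M" for n
  proof (induction n rule: less_induct)
    case (less n)
    then show ?case
      using p[of "z ` {..<n}"] by (auto simp: z_eq[of n])
  qed
  have "\<epsilon> \<le> d (z i) (z j)" if "i < j" for i j
  proof -
    have "z j \<notin> mball (z i) \<epsilon>"
      using p[of "z ` {..<j}"] z_M that by (auto simp: z_eq[of j])
    then show ?thesis
      using z_M by simp
  qed
  then have "\<epsilon> \<le> d (z i) (z j)" if "i \<noteq> j" for i j
    using that by (metis commute nat_neq_iff)
  then show thesis
    using that[of \<epsilon> z] \<epsilon> z_M by blast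
qed

context Metric_space
begin

text \<open>
  The functions vanish in the limit at every point but keep slopes of size \<open>c\<close> on one fixed
  sequence of pairs: for each late \<open>n\<close> the pairs with large \<open>k\<close> see the slope of \<open>g n\<close>. No pair
  does so for all \<open>n\<close>, and this order of quantifiers is what separates pointwise convergence from
  weak convergence.
\<close>

definition persistent_slopes :: "(nat \<Rightarrow> 'a \<Rightarrow> real) \<Rightarrow> (nat \<Rightarrow> 'a) \<Rightarrow> (nat \<Rightarrow> 'a) \<Rightarrow> real \<Rightarrow> bool" where
  "persistent_slopes g x y c \<longleftrightarrow> c > 0 \<and>
    (\<forall>k. x k \<in> M \<and> y k \<in> M \<and> x k \<noteq> y k) \<and>
    (\<forall>n. \<forall>u\<in>M. \<forall>v\<in>M. \<bar>g n u - g n v\<bar> \<le> d u v) \<and>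
    (\<forall>u\<in>M. (\<lambda>n. g n u) \<longlonglongrightarrow> 0) \<and>
    (\<forall>\<^sub>F n in sequentially. \<forall>\<^sub>F k in sequentially. c * d (x k) (y k) \<le> g n (x k) - g n (y k))"

text \<open>
  The functions \<open>max 0 (d u e - n)\<close> vanish on ever larger balls around \<open>e\<close>, but between \<open>e\<close> and
  a very distant point they rise by almost the whole distance.
\<close>

lemma persistent_slopes_unbounded:
  assumes "e \<in> M" "\<not> mbounded M"
  shows "\<exists>g x y c. persistent_slopes g x y c"
proof -
  have "\<exists>x\<in>M. d x e > real k" for k
    using assms unfolding mbounded by (metis commute not_le)
  then obtain x where x: "\<And>k. x k \<in> M" "\<And>k. d (x k) e > real k"
    by metis
  define g where "g n u = max 0 (d u e - real n)" for n u
  have "persistent_slopes g x (\<lambda>_. e) (1/2)"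
    unfolding persistent_slopes_def
  proof (intro conjI allI ballI)
    show "x k \<noteq> e" for k
      using x[of k] assms(1) by auto
    show "\<bar>g n u - g n v\<bar> \<le> d u v" if "u \<in> M" "v \<in> M" for n u v
      using triangle[OF that assms(1)] triangle[OF that(2,1) assms(1)] commute[of u v]
      unfolding g_def by linarith
    show "(\<lambda>n. g n u) \<longlonglongrightarrow> 0" if "u \<in> M" for u
    proof (rule tendsto_eventually, rule eventually_sequentiallyI)
      show "g n u = 0" if "n \<ge> nat \<lceil>d u e\<rceil>" for n
        using that by (auto simp: g_def max_def)
    qed
    have "1/2 * d (x k) e \<le> g n (x k) - g n e" if "k \<ge> 2 * n" for n k
    proof -
      have "d (x k) e > 2 * real n"
        using x(2)[of k] that by linarith
      then show ?thesis
        using assms(1) by (simp add: g_def)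
    qed
    then have "\<forall>\<^sub>F k in sequentially. 1/2 * d (x k) e \<le> g n (x k) - g n e" for n
      by (rule eventually_sequentiallyI)
    then show "\<forall>\<^sub>F n in sequentially. \<forall>\<^sub>F k in sequentially. 1/2 * d (x k) e \<le> g n (x k) - g n e"
      by simp
  qed (use x assms in auto)
  then show ?thesis
    by blast
qed

text \<open>
  Let \<open>L u\<close> be the distance from \<open>u\<close> to the limit of \<open>z\<close> in the completion. The functions
  \<open>max 0 (1/(n+1) - L u)\<close> are peaks of height \<open>1/(n+1)\<close> with slope 1 near that limit. A point
  \<open>y k\<close> of the sequence, paired with one that is at least twice as close to the limit, sees a
  fixed fraction of this slope.
\<close>

lemma persistent_slopes_Cauchy:
  fixes z :: "nat \<Rightarrow> 'a"
  assumes z: "MCauchy z" "inj z"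
  shows "\<exists>g x y c. persistent_slopes g x y c"
proof -
  have zM: "z k \<in> M" for k
    using z by (auto simp: MCauchy_def)
  have tail: "\<exists>K. \<forall>n\<ge>K. \<forall>m\<ge>K. d (z n) (z m) < \<epsilon>" if "\<epsilon> > 0" for \<epsilon>
    using z that by (auto simp: MCauchy_def)
  have dd: "\<bar>d u w - d v w\<bar> \<le> d u v" if "u \<in> M" "v \<in> M" "w \<in> M" for u v w
    using triangle[OF that] triangle[OF that(2,1,3)] commute[of u v] by linarith
  define L where "L u = lim (\<lambda>k. d u (z k))" for u
  have L: "(\<lambda>k. d u (z k)) \<longlonglongrightarrow> L u" if u: "u \<in> M" for u
  proof -
    have "Cauchy (\<lambda>k. d u (z k))"
    proof (rule metric_CauchyI)
      fix \<epsilon> :: real assume "\<epsilon> > 0"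
      then obtain K where "\<forall>n\<ge>K. \<forall>m\<ge>K. d (z n) (z m) < \<epsilon>"
        using tail by blast
      then show "\<exists>K. \<forall>m\<ge>K. \<forall>n\<ge>K. dist (d u (z m)) (d u (z n)) < \<epsilon>"
        using dd[OF zM zM u] commute[of u] by (metis dist_real_def le_less_trans)
    qed
    then show ?thesis
      unfolding L_def by (simp add: Cauchy_convergent_iff convergent_LIMSEQ_iff)
  qed
  have L_nonneg: "L u \<ge> 0" if "u \<in> M" for u
    using LIMSEQ_le_const[OF L[OF that]] nonneg by blast
  have L_Lip: "\<bar>L u - L v\<bar> \<le> d u v" if "u \<in> M" "v \<in> M" for u v
  proof (rule LIMSEQ_le_const2)
    show "(\<lambda>k. \<bar>d u (z k) - d v (z k)\<bar>) \<longlonglongrightarrow> \<bar>L u - L v\<bar>"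
      using that by (intro tendsto_intros L)
  qed (use dd that zM in blast)
  have L_sum: "d u v \<le> L u + L v" if "u \<in> M" "v \<in> M" for u v
  proof (rule LIMSEQ_le_const)
    show "(\<lambda>k. d u (z k) + d v (z k)) \<longlonglongrightarrow> L u + L v"
      using that by (intro tendsto_intros L)
  qed (use triangle'[OF that(1) zM that(2)] in blast)
  have Lz: "(\<lambda>k. L (z k)) \<longlonglongrightarrow> 0"
  proof (rule LIMSEQ_I)
    fix \<epsilon> :: real assume "\<epsilon> > 0"
    then obtain K where K: "\<forall>n\<ge>K. \<forall>m\<ge>K. d (z n) (z m) < \<epsilon> / 2"
      using tail[of "\<epsilon> / 2"] by auto
    have "L (z n) \<le> \<epsilon> / 2" if "n \<ge> K" for n
      using K that less_imp_le by (intro LIMSEQ_le_const2[OF L[OF zM]]) blast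
    then show "\<exists>K. \<forall>n\<ge>K. norm (L (z n) - 0) < \<epsilon>"
      using \<open>\<epsilon> > 0\<close> L_nonneg[OF zM] by (intro exI[of _ K]) fastforce
  qed
  \<comment> \<open>Two points with \<open>L = 0\<close> coincide, so the injective sequence meets the limit at most once.\<close>
  obtain m where m: "\<And>k. k \<ge> m \<Longrightarrow> L (z k) > 0"
  proof (cases "\<exists>k. L (z k) = 0")
    case True
    then obtain k0 where k0: "L (z k0) = 0"
      by blast
    have "L (z k) > 0" if "k \<ge> Suc k0" for k
    proof -
      have "z k \<noteq> z k0"
        using that z(2) by (auto dest: injD)
      then have "d (z k) (z k0) > 0"
        using zM by simp
      then show ?thesis
        using L_sum[OF zM[of k] zM[of k0]] k0 by simp
    qed
    then show ?thesis
      using that by blast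
  next
    case False
    then show ?thesis
      using that[of 0] L_nonneg[OF zM] by (metis less_eq_real_def)
  qed
  have "\<exists>j. L (z j) \<le> L (z (k + m)) / 2" for k
  proof -
    have "\<forall>\<^sub>F j in sequentially. L (z j) < L (z (k + m)) / 2"
      using m[of "k + m"] by (intro order_tendstoD(2)[OF Lz]) auto
    then show ?thesis
      unfolding eventually_sequentially by (meson less_imp_le order_refl)
  qed
  then obtain j where j: "\<And>k. L (z (j k)) \<le> L (z (k + m)) / 2"
    by metis
  define x y where "x k = z (j k)" and "y k = z (k + m)" for k
  have xy: "x k \<in> M" "y k \<in> M" "L (x k) \<le> L (y k) / 2" "L (y k) > 0" for k
    using zM j m[of "k + m"] by (auto simp: x_def y_def)
  have Ly: "(\<lambda>k. L (y k)) \<longlonglongrightarrow> 0"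
    unfolding y_def by (rule LIMSEQ_ignore_initial_segment[OF Lz])
  define g where "g n u = max 0 (1 / real (Suc n) - L u)" for n u
  have "persistent_slopes g x y (1/3)"
    unfolding persistent_slopes_def
  proof (intro conjI allI ballI)
    show "x k \<noteq> y k" for k
      using xy[of k] by auto
    show "\<bar>g n u - g n v\<bar> \<le> d u v" if "u \<in> M" "v \<in> M" for n u v
      using L_Lip[OF that] unfolding g_def by linarith
    show "(\<lambda>n. g n u) \<longlonglongrightarrow> 0" if "u \<in> M" for u
    proof (rule tendsto_sandwich[where f = "\<lambda>_. 0" and h = "\<lambda>n. 1 / real (Suc n)"])
      show "(\<lambda>n. 1 / real (Suc n)) \<longlonglongrightarrow> 0"
        by (rule lim_1_over_n[THEN LIMSEQ_Suc])
    qed (use L_nonneg[OF that] in \<open>auto simp: g_def\<close>)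
    show "\<forall>\<^sub>F n in sequentially. \<forall>\<^sub>F k in sequentially. 1/3 * d (x k) (y k) \<le> g n (x k) - g n (y k)"
    proof (rule always_eventually, rule allI)
      fix n
      have "\<forall>\<^sub>F k in sequentially. L (y k) < 1 / real (Suc n)"
        by (intro order_tendstoD(2)[OF Ly]) simp
      then show "\<forall>\<^sub>F k in sequentially. 1/3 * d (x k) (y k) \<le> g n (x k) - g n (y k)"
      proof eventually_elim
        \<comment> \<open>The rise is \<open>L (y k) - L (x k) \<ge> L (y k) / 2\<close>, and the distance is at most
          \<open>L (x k) + L (y k) \<le> 3 L (y k) / 2\<close>.\<close>
        case (elim k)
        then show ?case
          using xy[of k] L_sum[OF xy(1)[of k] xy(2)[of k]] unfolding g_def by linarith
      qed
    qed
  qed (use xy in auto)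
  then show ?thesis
    by blast
qed

text \<open>
  Let \<open>g n\<close> be the supremum of the bumps \<open>max 0 (\<epsilon>/2 - d u (z k))\<close> with \<open>k \<ge> n\<close>. A given point
  lies in the support of at most one bump, because the points \<open>z k\<close> are separated, so \<open>g n\<close>
  vanishes there once \<open>n\<close> has passed that bump. As distances are bounded by some \<open>B\<close>, the rise
  from \<open>z 0\<close> to a peak has slope at least \<open>\<epsilon> / (2 B)\<close>.
\<close>

lemma persistent_slopes_separated:
  fixes z :: "nat \<Rightarrow> 'a"
  assumes \<epsilon>: "\<epsilon> > 0" and z: "\<And>k. z k \<in> M" and sep: "\<And>i j. i \<noteq> j \<Longrightarrow> \<epsilon> \<le> d (z i) (z j)"
    and bdd: "mbounded M"
  shows "\<exists>g x y c. persistent_slopes g x y c"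
proof -
  obtain B where B: "B > 0" "\<And>u v. \<lbrakk>u \<in> M; v \<in> M\<rbrakk> \<Longrightarrow> d u v \<le> B"
    using bdd unfolding mbounded_alt_pos by blast
  define b where "b k u = max 0 (\<epsilon>/2 - d u (z k))" for k u
  define g where "g n u = (SUP k\<in>{n..}. b k u)" for n u
  have b_bound: "b k u \<le> \<epsilon>/2" for k u
    using \<epsilon> nonneg[of u "z k"] unfolding b_def by linarith
  have b_bdd: "bdd_above ((\<lambda>k. b k u) ` {n..})" for n u
    using b_bound by (intro bdd_aboveI2)
  have g_upper: "b k u \<le> g n u" if "k \<ge> n" for k n u
    unfolding g_def using that by (intro cSUP_upper b_bdd) auto
  have g_zero: "g n u = 0" if "\<And>k. k \<ge> n \<Longrightarrow> \<epsilon>/2 \<le> d u (z k)" for n u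
  proof -
    have "b k u = 0" if "k \<in> {n..}" for k
      using \<open>\<And>k. k \<ge> n \<Longrightarrow> \<epsilon>/2 \<le> d u (z k)\<close>[of k] that by (simp add: b_def)
    then have "(\<lambda>k. b k u) ` {n..} = {0}"
      by (force simp: image_iff)
    then show ?thesis
      by (simp add: g_def)
  qed
  have g_le: "g n u \<le> g n v + d u v" if "u \<in> M" "v \<in> M" for n u v
    unfolding g_def[of n u]
  proof (rule cSUP_least)
    fix k assume "k \<in> {n..}"
    then have "b k v \<le> g n v"
      by (intro g_upper) simp
    moreover have "b k u \<le> b k v + d u v"
      using triangle[OF that(2,1) z[of k]] commute[of u v] nonneg[of u v] unfolding b_def by linarith
    ultimately show "b k u \<le> g n v + d u v"
      by simp
  qed simp
  have "persistent_slopes g (\<lambda>k. z (Suc k)) (\<lambda>_. z 0) (\<epsilon> / (2 * B))"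
    unfolding persistent_slopes_def
  proof (intro conjI allI ballI)
    show "z (Suc k) \<noteq> z 0" for k
      using sep[of "Suc k" 0] \<epsilon> z by auto
    show "\<bar>g n u - g n v\<bar> \<le> d u v" if "u \<in> M" "v \<in> M" for n u v
      using g_le[OF that, of n] g_le[OF that(2,1), of n] commute[of u v] by linarith
    show "(\<lambda>n. g n u) \<longlonglongrightarrow> 0" if u: "u \<in> M" for u
    proof (cases "\<exists>i. d u (z i) < \<epsilon>/2")
      case True
      then obtain i where i: "d u (z i) < \<epsilon>/2"
        by blast
      have "\<epsilon>/2 \<le> d u (z k)" if "k \<noteq> i" for k
        using sep[OF that] triangle'[OF z[of k] u z[of i]] commute i by (smt (verit) field_sum_of_halves)
      then have "g n u = 0" if "n \<ge> Suc i" for n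
        using that by (intro g_zero) auto
      then show ?thesis
        by (intro tendsto_eventually eventually_sequentiallyI)
    next
      case False
      then show ?thesis
        by (simp add: g_zero not_less)
    qed
    have slope: "\<epsilon> / (2 * B) * d (z (Suc k)) (z 0) \<le> g n (z (Suc k)) - g n (z 0)"
      if "n \<ge> 1" "k \<ge> n" for n k
    proof -
      have "\<epsilon>/2 \<le> d (z 0) (z i)" if "i \<ge> n" for i
        using sep[of 0 i] \<epsilon> that \<open>n \<ge> 1\<close> by force
      then have "g n (z 0) = 0"
        by (rule g_zero)
      moreover have "b (Suc k) (z (Suc k)) = \<epsilon>/2"
        using \<epsilon> z by (simp add: b_def)
      then have "g n (z (Suc k)) \<ge> \<epsilon>/2"
        using g_upper[of n "Suc k" "z (Suc k)"] that by simp
      moreover have "\<epsilon> / (2 * B) * d (z (Suc k)) (z 0) \<le> \<epsilon> / (2 * B) * B"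
        using \<epsilon> B z by (intro mult_left_mono) auto
      ultimately show ?thesis
        using B by simp
    qed
    show "\<forall>\<^sub>F n in sequentially. \<forall>\<^sub>F k in sequentially.
        \<epsilon> / (2 * B) * d (z (Suc k)) (z 0) \<le> g n (z (Suc k)) - g n (z 0)"
      using slope by (intro eventually_sequentiallyI) blast
  qed (use \<epsilon> B z in auto)
  then show ?thesis
    by blast
qed

text \<open>
  The three constructions are exhaustive: a bounded space either is totally bounded, and then an
  injective sequence has a Cauchy subsequence, or contains an infinite separated set.
\<close>

lemma infinite_persistent_slopes:
  assumes "infinite M"
  shows "\<exists>g x y c. persistent_slopes g x y c"
proof (cases "mbounded M")
  case False
  moreover obtain e where "e \<in> M"
    using assms by fastforce
  ultimately show ?thesis
    by (intro persistent_slopes_unbounded)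
next
  case bdd: True
  show ?thesis
  proof (cases "mtotally_bounded M")
    case True
    obtain s :: "nat \<Rightarrow> 'a" where s: "inj s" "range s \<subseteq> M"
      using infinite_countable_subset[OF assms] by blast
    then obtain r where "strict_mono r" "MCauchy (s \<circ> r)"
      using True unfolding mtotally_bounded_sequentially by blast
    then show ?thesis
      using s by (intro persistent_slopes_Cauchy[of "s \<circ> r"] inj_compose strict_mono_imp_inj_on)
  next
    case False
    then show ?thesis
      using bdd by (elim separated_sequence) (rule persistent_slopes_separated)
  qed
qed

end

section \<open>Weakly compact sets of Lipschitz functions\<close>

lemma continuous_map_Lip0_weak:
  assumes "\<phi> \<in> Lip0_dual M e"
  shows "continuous_map (Lip0_weak M e) euclideanreal \<phi>"
  unfolding continuous_map_def
proof (intro conjI allI impI)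
  fix U :: "real set" assume "openin euclideanreal U"
  then show "openin (Lip0_weak M e) {f \<in> topspace (Lip0_weak M e). \<phi> f \<in> U}"
    unfolding topspace_Lip0_weak unfolding Lip0_weak_def
    using assms by (intro topology_generated_by_Basis) auto
qed auto

lemma evaluation_in_Lip0_dual:
  assumes "e \<in> mspace M" "x \<in> mspace M"
  shows "(\<lambda>f. f x) \<in> Lip0_dual M e"
proof -
  have "\<bar>f x\<bar> \<le> mdist M x e * Lip0_norm M f" if "f \<in> Lip0 M e" for f
    using Lip0_norm_bound[OF that assms(2,1)] that by (simp add: Lip0_iff mult.commute)
  then show ?thesis
    using assms by (auto simp: Lip0_dual_def)
qed

lemma compactin_Lip0_weak_imp_pointwise:
  assumes "e \<in> mspace M" "compactin (Lip0_weak M e) K"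
  shows "compactin (powertop_real (mspace M)) K"
proof -
  have "continuous_map (Lip0_weak M e) (powertop_real (mspace M)) id"
    using assms(1) continuous_map_Lip0_weak[OF evaluation_in_Lip0_dual]
    by (auto simp: continuous_map_componentwise Lip0_iff)
  from image_compactin[OF assms(2) this] show ?thesis
    by simp
qed

text \<open>
  The functions with persistent slopes, scaled and translated into the ball provided by Baire's
  theorem, have a weak cluster point. Evaluations identify it as the centre of the ball, while the
  functional obtained from the difference quotients keeps them away from the centre.
\<close>

lemma Lip0_weak_not_sigma_compact:
  assumes e: "e \<in> mspace M" and inf: "infinite (mspace M)"
    and K: "\<And>n::nat. compactin (Lip0_weak M e) (K n)"
  shows "(\<Union>n. K n) \<noteq> Lip0 M e"
proof
  assume cover: "(\<Union>n. K n) = Lip0 M e"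
  let ?I = "mspace M" and ?L = "Lip0 M e"
  obtain g x y c where "Metric_space.persistent_slopes ?I (mdist M) g x y c"
    using Metric_space.infinite_persistent_slopes[OF Metric_space_mspace_mdist inf] by blast
  then have c: "c > 0" and xy: "\<And>k. x k \<in> ?I" "\<And>k. y k \<in> ?I" "\<And>k. x k \<noteq> y k"
    and g_Lip: "\<And>n u v. \<lbrakk>u \<in> ?I; v \<in> ?I\<rbrakk> \<Longrightarrow> \<bar>g n u - g n v\<bar> \<le> mdist M u v"
    and g_lim: "\<And>u. u \<in> ?I \<Longrightarrow> (\<lambda>n. g n u) \<longlonglongrightarrow> 0"
    and slopes: "\<forall>\<^sub>F n in sequentially. \<forall>\<^sub>F k in sequentially.
      c * mdist M (x k) (y k) \<le> g n (x k) - g n (y k)"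
    unfolding Metric_space.persistent_slopes_def[OF Metric_space_mspace_mdist] by blast+
  obtain \<phi> where \<phi>: "\<phi> \<in> Lip0_dual M e"
    and \<phi>_ge: "\<And>f c. \<lbrakk>f \<in> ?L; \<forall>\<^sub>F k in sequentially. c * mdist M (x k) (y k) \<le> f (x k) - f (y k)\<rbrakk>
       \<Longrightarrow> c \<le> \<phi> f"
    by (rule difference_quotient_functional[where x = x and y = y, OF e xy]) blast
  define h where "h n = (\<lambda>u\<in>?I. g n u - g n e)" for n
  have h_L: "h n \<in> ?L" for n
    using g_Lip e by (intro Lip0I[of _ _ _ 1]) (auto simp: h_def)
  have h_\<phi>: "\<forall>\<^sub>F n in sequentially. c \<le> \<phi> (h n)"
    using slopes
  proof eventually_elim
    case (elim n)
    then show ?case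
      using xy by (intro \<phi>_ge[OF h_L]) (simp add: h_def)
  qed
  have zero: "(\<lambda>u\<in>?I. 0) \<in> ?L"
    using e by (intro Lip0I[of _ _ _ 0]) auto
  obtain n f r where f: "f \<in> ?L" and r: "r > 0"
    and ball: "\<And>g. \<lbrakk>g \<in> ?L; Lip0_dist M f g < r\<rbrakk> \<Longrightarrow> g \<in> K n"
  proof (rule Baire_pointwise_compact[OF Metric_space_Lip0[OF e] mcomplete_Lip0[OF e]])
    show "?L \<noteq> {}"
      using zero by blast
    show "?L \<subseteq> extensional ?I"
      by (auto simp: Lip0_iff)
    show "\<exists>B. \<forall>f\<in>?L. \<forall>g\<in>?L. \<bar>f u - g u\<bar> \<le> B * Lip0_dist M f g" if "u \<in> ?I" for u
      using Lip0_dist_eval[OF e _ _ that] by blast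
    show "compactin (powertop_real ?I) (K n)" for n
      by (rule compactin_Lip0_weak_imp_pointwise[OF e K])
    show "?L \<subseteq> (\<Union>n. K n)"
      by (simp add: cover)
  qed (rule that)
  define s where "s k = (\<lambda>u\<in>?I. f u + r/2 * h k u)" for k
  have s_L: "s k \<in> ?L" for k
    unfolding s_def using Lip0_lincomb[OF f h_L e, of 1 "r/2"] by simp
  have s_K: "s k \<in> K n" for k
  proof (rule ball[OF s_L])
    have "Lip0_dist M f (s k) \<le> r/2"
    proof (rule Lip0_dist_le[OF e f s_L])
      fix u v assume uv: "u \<in> ?I" "v \<in> ?I"
      have "(f u - s k u) - (f v - s k v) = r/2 * (g k v - g k u)"
        using uv by (simp add: s_def h_def field_simps)
      then have "\<bar>(f u - s k u) - (f v - s k v)\<bar> = \<bar>r/2 * (g k v - g k u)\<bar>"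
        by (rule arg_cong)
      also have "\<dots> \<le> r/2 * mdist M u v"
        unfolding abs_mult using g_Lip[OF uv(2,1), of k] r by (auto simp: mdist_commute)
      finally show "\<bar>(f u - s k u) - (f v - s k v)\<bar> \<le> r/2 * mdist M u v" .
    qed (use r in simp)
    then show "Lip0_dist M f (s k) < r"
      using r by linarith
  qed
  obtain w where w: "w \<in> K n"
    and clus: "\<And>h C. \<lbrakk>continuous_map (Lip0_weak M e) euclideanreal h; closed C;
      \<forall>\<^sub>F k in sequentially. h (s k) \<in> C\<rbrakk> \<Longrightarrow> h w \<in> C"
    by (rule compactin_filter_cluster[where s = s, OF K trivial_limit_sequentially s_K]) blast
  have "w u = f u" if u: "u \<in> ?I" for u
  proof (rule ccontr)
    assume "w u \<noteq> f u"
    have "(\<lambda>k. f u + r/2 * (g k u - g k e)) \<longlonglongrightarrow> f u + r/2 * (0 - 0)"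
      by (intro tendsto_intros g_lim u e)
    then have "(\<lambda>k. s k u) \<longlonglongrightarrow> f u"
      using u by (simp add: s_def h_def)
    then have "\<forall>\<^sub>F k in sequentially. dist (s k u) (f u) < \<bar>w u - f u\<bar> / 2"
      using \<open>w u \<noteq> f u\<close> by (intro tendstoD) auto
    then have "\<forall>\<^sub>F k in sequentially. s k u \<in> cball (f u) (\<bar>w u - f u\<bar> / 2)"
      by eventually_elim (simp add: dist_commute)
    from clus[OF continuous_map_Lip0_weak[OF evaluation_in_Lip0_dual[OF e u]] closed_cball this]
    show False
      using \<open>w u \<noteq> f u\<close> by (auto simp: dist_real_def abs_minus_commute)
  qed
  moreover have "w \<in> ?L"
    using w cover by blast
  ultimately have wf: "w = f"
    using f by (intro extensionalityI[of _ ?I]) (auto simp: Lip0_iff)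
  have \<phi>_s: "\<phi> (s k) = \<phi> f + r/2 * \<phi> (h k)" for k
  proof -
    define p where "p = (\<lambda>u\<in>?I. r/2 * h k u)"
    have "p \<in> ?L"
      using Lip0_lincomb[OF h_L h_L e, of "r/2" k 0 k] by (simp add: p_def)
    moreover have "s k = (\<lambda>u\<in>?I. f u + p u)"
      by (auto simp: s_def p_def)
    moreover have "\<phi> p = r/2 * \<phi> (h k)"
      using \<phi> h_L unfolding Lip0_dual_def p_def by blast
    ultimately show ?thesis
      using \<phi> f unfolding Lip0_dual_def by auto
  qed
  have "\<forall>\<^sub>F k in sequentially. \<phi> (s k) \<in> {\<phi> f + r/2 * c..}"
    using h_\<phi> by eventually_elim (use r in \<open>simp add: \<phi>_s\<close>)
  from clus[OF continuous_map_Lip0_weak[OF \<phi>] _ this] have "r/2 * c \<le> 0"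
    by (simp add: wf)
  then show False
    using r c by (simp add: mult_le_0_iff)
qed

section \<open>Pointwise compact sets of continuous functions\<close>

text \<open>
  Complete regularity separates each point of \<open>A\<close> from the others. Truncating the sum at 1 keeps
  the values in the unit interval without affecting those on \<open>A\<close>.
\<close>

lemma tychonoff_interpolation:
  fixes h :: "'a \<Rightarrow> real"
  assumes X: "tychonoff_space X" and A: "finite A" "A \<subseteq> topspace X"
    and h: "\<And>x. x \<in> A \<Longrightarrow> h x \<in> {0..1}"
  obtains g where "continuous_map X euclideanreal g" "\<And>x. x \<in> topspace X \<Longrightarrow> g x \<in> {0..1}"
    "\<And>x. x \<in> A \<Longrightarrow> g x = h x"
proof -
  have bump: "\<exists>b. continuous_map X (top_of_set {0..1::real}) b \<and> b x = 0 \<and> b ` (A - {x}) \<subseteq> {1}"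
    if "x \<in> A" for x
  proof -
    have "closedin X (A - {x})"
      using X A by (intro closedin_Hausdorff_finite) (auto simp: tychonoff_space_def)
    moreover have "x \<in> topspace X - (A - {x})"
      using that A by blast
    ultimately show ?thesis
      using X unfolding tychonoff_space_def completely_regular_space_def by presburger
  qed
  obtain b where b: "\<And>x. x \<in> A \<Longrightarrow> continuous_map X (top_of_set {0..1::real}) (b x)"
    "\<And>x. x \<in> A \<Longrightarrow> b x x = 0" "\<And>x. x \<in> A \<Longrightarrow> b x ` (A - {x}) \<subseteq> {1}"
    using bump by metis
  have b_cont: "continuous_map X euclideanreal (b x)"
    and b_01: "y \<in> topspace X \<Longrightarrow> b x y \<in> {0..1}" if "x \<in> A" for x y
    using b(1)[OF that] by (auto simp: continuous_map_in_subtopology Pi_iff)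
  define g where "g y = min 1 (\<Sum>x\<in>A. h x * (1 - b x y))" for y
  show thesis
  proof (rule that)
    show "continuous_map X euclideanreal g"
      unfolding g_def
      by (intro continuous_map_real_min continuous_map_sum continuous_map_real_mult
          continuous_map_diff b_cont A) auto
    show "g y \<in> {0..1}" if "y \<in> topspace X" for y
      using h b_01[OF _ that] by (auto simp: g_def intro!: sum_nonneg mult_nonneg_nonneg)
    show "g y = h y" if "y \<in> A" for y
    proof -
      have "h x * (1 - b x y) = (if x = y then h y else 0)" if "x \<in> A" for x
        using b(2)[OF that] b(3)[OF that] \<open>y \<in> A\<close> by auto
      then have "(\<Sum>x\<in>A. h x * (1 - b x y)) = (\<Sum>x\<in>A. if x = y then h y else 0)"
        by (intro sum.cong) auto
      also have "\<dots> = h y"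
        using A that by simp
      finally show ?thesis
        using h[OF that] by (simp add: g_def)
    qed
  qed
qed

text \<open>
  One of the compact sets contains a supremum-norm ball around some \<open>f\<close> of radius \<open>r\<close>. It contains
  \<open>f + (r/2) g\<close> for every continuous \<open>g\<close> with values in the unit interval. Interpolating \<open>h\<close> on
  finite sets \<open>A\<close> and letting \<open>A\<close> grow yields the cluster point \<open>f + (r/2) h\<close>, which lies in the
  compact set and is therefore continuous.
\<close>

lemma Cfun_sigma_compact_imp_continuous:
  fixes h :: "'a \<Rightarrow> real"
  assumes X: "tychonoff_space X" "topspace X \<noteq> {}"
    and K: "\<And>n::nat. compactin (Cfun_pointwise X) (K n)" and cover: "(\<Union>n. K n) = Cfun X"
    and h: "\<And>x. x \<in> topspace X \<Longrightarrow> h x \<in> {0..1}"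
  shows "continuous_map X euclideanreal h"
proof -
  let ?m = "cfunspace X euclidean_metric :: ('a \<Rightarrow> real) metric"
  let ?S = "mspace ?m" and ?I = "topspace X"
  have S_iff: "f \<in> ?S \<longleftrightarrow> f \<in> extensional ?I \<and> bounded (f ` ?I) \<and> continuous_map X euclideanreal f" for f
    by (simp add: Pi_iff)
  have pw: "compactin (powertop_real ?I) (K n)" for n
    using K[of n] by (simp add: Cfun_pointwise_def compactin_subtopology)
  have "Met_TC.Self = (euclidean_metric :: real metric)"
    by (simp add: euclidean_metric_def Met_TC.Self_def)
  then have compl: "Metric_space.mcomplete ?S (mdist ?m)"
    using Met_TC.mcomplete_cfunspace[where 'a = real and 'b = 'a and X = X]
    unfolding mcomplete_of_def by (simp only: mcomplete_iff_complete complete_UNIV)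
  have zero: "(\<lambda>x\<in>?I. 0) \<in> ?S"
    unfolding S_iff by (auto simp: bounded_real intro: continuous_map_eq[of _ _ "\<lambda>_. 0"])
  have sub: "?S \<subseteq> (\<Union>n. K n)"
    unfolding cover by (rule subsetI, unfold S_iff Cfun_def) simp
  have eval: "\<bar>f x - g x\<bar> \<le> 1 * mdist ?m f g" if "f \<in> ?S" "g \<in> ?S" "x \<in> ?I" for f g x
    using mdist_cfunspace_imp_mdist_le[OF that(1,2) order_refl that(3)] by (simp add: dist_real_def)
  obtain n f r where f: "f \<in> ?S" and r: "r > 0"
    and ball: "\<And>g. \<lbrakk>g \<in> ?S; mdist ?m f g < r\<rbrakk> \<Longrightarrow> g \<in> K n"
  proof (rule Baire_pointwise_compact[OF Metric_space_mspace_mdist compl])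
    show "?S \<subseteq> extensional ?I"
      by (rule subsetI, unfold S_iff) simp
    show "?S \<noteq> {}"
      using zero by blast
    show "\<exists>B. \<forall>f\<in>?S. \<forall>g\<in>?S. \<bar>f x - g x\<bar> \<le> B * mdist ?m f g" if "x \<in> ?I" for x
      using eval that by blast
  qed (rule pw, rule sub, rule that)
  have "\<exists>g. continuous_map X euclideanreal g \<and> (\<forall>x\<in>?I. g x \<in> {0..1}) \<and>
      (finite A \<and> A \<subseteq> ?I \<longrightarrow> (\<forall>x\<in>A. g x = h x))" for A
  proof (cases "finite A \<and> A \<subseteq> ?I")
    case True
    then have A: "finite A" "A \<subseteq> ?I" and hA: "\<And>x. x \<in> A \<Longrightarrow> h x \<in> {0..1}"
      using h by blast+
    obtain g where "continuous_map X euclideanreal g" "\<And>x. x \<in> ?I \<Longrightarrow> g x \<in> {0..1}"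
      "\<And>x. x \<in> A \<Longrightarrow> g x = h x"
      by (rule tychonoff_interpolation[where h = h, OF X(1) A hA]) blast+
    then show ?thesis
      by blast
  next
    case False
    then show ?thesis
      by (intro exI[of _ "\<lambda>_. 0"]) auto
  qed
  then obtain g where g: "\<And>A. continuous_map X euclideanreal (g A)"
    "\<And>A x. x \<in> ?I \<Longrightarrow> g A x \<in> {0..1}"
    "\<And>A x. \<lbrakk>finite A; A \<subseteq> ?I; x \<in> A\<rbrakk> \<Longrightarrow> g A x = h x"
    by metis
  define s where "s A = (\<lambda>x\<in>?I. f x + r/2 * g A x)" for A
  have s_K: "s A \<in> K n" for A
  proof (rule ball)
    have "bounded ((\<lambda>x. f x + r/2 * g A x) ` ?I)"
    proof -
      obtain B where "\<And>x. x \<in> ?I \<Longrightarrow> \<bar>f x\<bar> \<le> B"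
        using f unfolding S_iff bounded_real by blast
      moreover have "\<bar>r/2 * g A x\<bar> \<le> r/2" if "x \<in> ?I" for x
        using g(2)[OF that, of A] r by (simp add: abs_mult mult_le_one)
      ultimately have "\<bar>f x + r/2 * g A x\<bar> \<le> B + r/2" if "x \<in> ?I" for x
        using that by (smt (verit))
      then show ?thesis
        by (auto simp: bounded_real)
    qed
    moreover have "continuous_map X euclideanreal (\<lambda>x. f x + r/2 * g A x)"
      using f unfolding S_iff
      by (intro continuous_map_add continuous_map_real_mult_left g) auto
    ultimately show sS: "s A \<in> ?S"
      unfolding S_iff s_def by (auto intro: continuous_map_eq)
    have "mdist ?m f (s A) \<le> r/2"
      unfolding cfunspace_mdist_le[OF f sS X(2)]
      using g(2)[of _ A] r by (auto simp: s_def dist_real_def abs_mult)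
    then show "mdist ?m f (s A) < r"
      using r by linarith
  qed
  obtain u where u: "u \<in> K n"
    and clus: "\<And>h C. \<lbrakk>continuous_map (powertop_real ?I) euclideanreal h; closed C;
      \<forall>\<^sub>F A in finite_subsets_at_top ?I. h (s A) \<in> C\<rbrakk> \<Longrightarrow> h u \<in> C"
    by (rule compactin_filter_cluster[where s = s and F = "finite_subsets_at_top ?I", OF pw finite_subsets_at_top_neq_bot s_K]) blast
  have u_eq: "u x = f x + r/2 * h x" if x: "x \<in> ?I" for x
  proof -
    have "\<forall>\<^sub>F A in finite_subsets_at_top ?I. s A x \<in> {f x + r/2 * h x}"
      unfolding eventually_finite_subsets_at_top
      using x g(3) by (intro exI[of _ "{x}"]) (auto simp: s_def)
    then have "u x \<in> {f x + r/2 * h x}"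
      using x by (intro clus[of "\<lambda>f. f x"] continuous_map_product_projection) auto
    then show ?thesis
      by simp
  qed
  have "continuous_map X euclideanreal (\<lambda>x. (u x - f x) * (2 / r))"
    using u f cover unfolding S_iff Cfun_def
    by (intro continuous_map_real_mult_right continuous_map_diff) blast+
  then show ?thesis
    by (rule continuous_map_eq) (use u_eq r in auto)
qed

text \<open>
  Otherwise indicator functions would be continuous and \<open>X\<close> discrete. Evaluation at a point is
  bounded on each compact set, so on distinct points \<open>p n\<close> a function can be chosen to exceed the
  bound of the \<open>n\<close>-th set at \<open>p n\<close>, and it lies in none of them.
\<close>

lemma Cfun_pointwise_not_sigma_compact:
  assumes X: "tychonoff_space X" and inf: "infinite (topspace X)"
    and K: "\<And>n::nat. compactin (Cfun_pointwise X) (K n)"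
  shows "(\<Union>n. K n) \<noteq> Cfun X"
proof
  assume cover: "(\<Union>n. K n) = Cfun X"
  let ?I = "topspace X"
  have "openin X S" if "S \<subseteq> ?I" for S
  proof -
    have "continuous_map X euclideanreal (indicat_real S)"
      using inf by (intro Cfun_sigma_compact_imp_continuous[OF X _ K cover])
        (auto simp: indicator_def)
    then have "openin X {x \<in> ?I. indicat_real S x \<in> {0<..}}"
      by (rule openin_continuous_map_preimage) simp
    moreover have "{x \<in> ?I. indicat_real S x \<in> {0<..}} = S"
      using that by (auto simp: indicator_def)
    ultimately show ?thesis
      by simp
  qed
  then have all: "continuous_map X euclideanreal f" for f
    by (simp add: continuous_map_def)
  obtain p :: "nat \<Rightarrow> 'a" where p: "inj p" "range p \<subseteq> ?I"
    using infinite_countable_subset[OF inf] by blast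
  have "\<exists>c. \<forall>f\<in>K n. \<bar>f (p n)\<bar> \<le> c" for n
  proof -
    have "continuous_map (Cfun_pointwise X) euclideanreal (\<lambda>f. f (p n))"
      using p unfolding Cfun_pointwise_def
      by (intro continuous_map_from_subtopology continuous_map_product_projection) auto
    then have "compact ((\<lambda>f. f (p n)) ` K n)"
      using image_compactin[OF K] by fastforce
    then show ?thesis
      by (auto simp: bounded_real dest!: compact_imp_bounded)
  qed
  then obtain c where c: "\<And>n f. f \<in> K n \<Longrightarrow> \<bar>f (p n)\<bar> \<le> c n"
    by metis
  define f where "f = (\<lambda>x\<in>?I. c (inv p x) + 1)"
  have "f \<in> Cfun X"
    using all by (simp add: Cfun_def f_def)
  then obtain n where "f \<in> K n"
    using cover by blast
  then have "f (p n) \<le> c n"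
    using c by fastforce
  moreover have "f (p n) = c n + 1"
    using p by (auto simp: f_def)
  ultimately show False
    by simp
qed

section \<open>Continuous images of Lipschitz function spaces\<close>

text \<open>
  The value 0 at \<open>e\<close> confines \<open>f x\<close> to the interval of radius \<open>n * mdist M x e\<close>. The Lipschitz
  condition is closed in the product of these intervals, which is compact by Tychonoff's theorem.
\<close>

lemma Lip0_Lipschitz_ball_compact:
  assumes e: "e \<in> mspace M"
  shows "compactin (Lip0_pointwise M e)
    {f \<in> Lip0 M e. \<forall>x\<in>mspace M. \<forall>y\<in>mspace M. \<bar>f x - f y\<bar> \<le> real n * mdist M x y}"
    (is "compactin _ ?B")
proof -
  let ?I = "mspace M" and ?P = "powertop_real (mspace M)"
  let ?box = "\<Pi>\<^sub>E x\<in>?I. {- (real n * mdist M x e)..real n * mdist M x e}"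
  let ?C = "\<lambda>x y. {f \<in> topspace ?P. \<bar>f x - f y\<bar> \<in> {..real n * mdist M x y}}"
  have box: "compactin ?P ?box"
    by (simp add: compactin_PiE)
  have "closedin ?P (?C x y)" if "x \<in> ?I" "y \<in> ?I" for x y
    using that
    by (intro closedin_continuous_map_preimage[where Y = euclideanreal] continuous_map_real_abs
        continuous_map_diff continuous_map_product_projection) auto
  then have "closedin ?P (\<Inter>x\<in>?I. \<Inter>y\<in>?I. ?C x y)"
    using e by (intro closedin_INT) blast+
  then have "compactin ?P (?box \<inter> (\<Inter>x\<in>?I. \<Inter>y\<in>?I. ?C x y))"
    by (rule compact_Int_closedin[OF box])
  moreover have "?box \<inter> (\<Inter>x\<in>?I. \<Inter>y\<in>?I. ?C x y) = ?B"
  proof (intro equalityI subsetI)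
    fix f assume f: "f \<in> ?box \<inter> (\<Inter>x\<in>?I. \<Inter>y\<in>?I. ?C x y)"
    \<comment> \<open>The interval at \<open>e\<close> is \<open>{0}\<close>, so the box already encodes \<open>f e = 0\<close>.\<close>
    then have "f e \<in> {- (real n * mdist M e e)..real n * mdist M e e}"
      using e by (blast dest: PiE_mem)
    moreover have "mdist M e e = 0"
      using e by simp
    ultimately have "f e = 0"
      by simp
    then show "f \<in> ?B"
      using f by (auto simp: PiE_iff intro!: Lip0I[of _ _ _ "real n"])
  next
    fix f assume f: "f \<in> ?B"
    then have "f e = 0" "f \<in> extensional ?I"
      by (auto simp: Lip0_iff)
    then show "f \<in> ?box \<inter> (\<Inter>x\<in>?I. \<Inter>y\<in>?I. ?C x y)"
      using f e by (force simp: PiE_iff abs_le_iff)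
  qed
  ultimately show ?thesis
    unfolding Lip0_pointwise_def compactin_subtopology by auto
qed

lemma Lip0_pointwise_image_sigma_compact:
  assumes e: "e \<in> mspace M" and T: "continuous_map (Lip0_pointwise M e) Y T"
  obtains K :: "nat \<Rightarrow> _" where "\<And>n. compactin Y (K n)" "(\<Union>n. K n) = T ` Lip0 M e"
proof -
  let ?B = "\<lambda>n::nat. {f \<in> Lip0 M e. \<forall>x\<in>mspace M. \<forall>y\<in>mspace M. \<bar>f x - f y\<bar> \<le> real n * mdist M x y}"
  have "f \<in> (\<Union>n. ?B n)" if f: "f \<in> Lip0 M e" for f
  proof -
    obtain n :: nat where "Lip0_norm M f \<le> real n"
      using real_arch_simple by blast
    then have "Lip0_norm M f * mdist M x y \<le> real n * mdist M x y" for x y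
      by (intro mult_right_mono) auto
    then have "f \<in> ?B n"
      using f Lip0_norm_bound[OF f] order_trans by blast
    then show ?thesis
      by blast
  qed
  then have "(\<Union>n. ?B n) = Lip0 M e"
    by blast
  then have "(\<Union>n. T ` ?B n) = T ` Lip0 M e"
    by (metis image_UN)
  then show thesis
    using that[of "\<lambda>n. T ` ?B n"] image_compactin[OF Lip0_Lipschitz_ball_compact[OF e] T] by blast
qed

lemma compactin_coarser_topology:
  assumes "topology_contains S T" "compactin S K"
  shows "compactin T K"
proof -
  have "continuous_map S T id"
    using assms(1) openin_subset
    by (auto simp: topology_contains_def continuous_map_def Collect_conj_eq Int_absorb1)
  from image_compactin[OF assms(2) this] show ?thesis
    by simp
qed

theorem theorem4p3:
  fixes M :: "'a metric" and e :: 'a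
    and N :: "'b metric" and e' :: 'b
    and X :: "'c topology"
    and \<tau> :: "('b \<Rightarrow> real) topology"
    and \<tau>' :: "('c \<Rightarrow> real) topology"
  assumes "infinite (mspace M)" and "e \<in> mspace M"
    and "infinite (mspace N)" and "e' \<in> mspace N"
    and "infinite (topspace X)" and "tychonoff_space X"
    and "topspace \<tau> = Lip0 N e'" and "topology_contains \<tau> (Lip0_weak N e')"
    and "topspace \<tau>' = Cfun X" and "topology_contains \<tau>' (Cfun_pointwise X)"
  shows "(\<nexists>T. continuous_map (Lip0_pointwise M e) \<tau> T \<and> T ` Lip0 M e = Lip0 N e')
       \<and> (\<nexists>T. continuous_map (Lip0_pointwise M e) \<tau>' T \<and> T ` Lip0 M e = Cfun X)"
proof (intro conjI notI; elim exE conjE)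
  fix T assume "continuous_map (Lip0_pointwise M e) \<tau> T" "T ` Lip0 M e = Lip0 N e'"
  then obtain K where "\<And>n::nat. compactin \<tau> (K n)" "(\<Union>n. K n) = Lip0 N e'"
    using Lip0_pointwise_image_sigma_compact[OF assms(2)] by metis
  then show False
    using Lip0_weak_not_sigma_compact[OF assms(4,3)] compactin_coarser_topology[OF assms(8)] by blast
next
  fix T assume "continuous_map (Lip0_pointwise M e) \<tau>' T" "T ` Lip0 M e = Cfun X"
  then obtain K where "\<And>n::nat. compactin \<tau>' (K n)" "(\<Union>n. K n) = Cfun X"
    using Lip0_pointwise_image_sigma_compact[OF assms(2)] by metis
  then show False
    using Cfun_pointwise_not_sigma_compact[OF assms(6,5)] compactin_coarser_topology[OF assms(10)]
    by blast
qed

end
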